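(* Let $\Gamma$ be a Shilla distance-regular graph with $b(\Gamma)=b\geq 2$ and with eigenvalue multiplicities satisfying $m_2=m_3$. Then: (i) $a_3-b<b_2+c_2<a_3+b$; (ii) $c_2<b_2+b$; (iii) if $b_2+c_2=a_3$ or $b_2=c_2$, then $a_3=\frac{b(b-1)}{2}$.
   Context: A connected graph $\Gamma$ of diameter $D$ is distance-regular if there are integers $b_i,c_i$ ($0\le i\le D$) such that for any two vertices $x,y$ at distance $i$, exactly $c_i$ neighbours of $y$ are at distance $i-1$ from $x$ and exactly $b_i$ neighbours of $y$ are at distance $i+1$ from $x$. Then $\Gamma$ is regular of valency $k=b_0$, and $a_i:=k-b_i-c_i$. The eigenvalues of $\Gamma$ are those of its adjacency matrix; $\Gamma$ has exactly $D+1$ distinct eigenvalues $k=\theta_0>\theta_1>\dots>\theta_D$, and $m_i$ denotes the multiplicity of $\theta_i$. A Shilla distance-regular graph is a distance-regular graph of diameter $3$ whose second largest eigenvalue satisfies $\theta_1=a_3$. For such graphs $k=(a_3-a_1)a_3$, and one defines $b(\Gamma):=a_3-a_1=k/a_3$. *)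

theory Defs
  imports "Jordan_Normal_Form.Char_Poly"
begin

text \<open>A finite graph on the vertex set {0..<n}, adjacency given by E (only pairs
of vertices below n matter).\<close>

definition adj_rel :: "(nat \<Rightarrow> nat \<Rightarrow> bool) \<Rightarrow> nat \<Rightarrow> (nat \<times> nat) set" where
  "adj_rel E n = {(x, y). x < n \<and> y < n \<and> E x y}"

definition gdist :: "(nat \<Rightarrow> nat \<Rightarrow> bool) \<Rightarrow> nat \<Rightarrow> nat \<Rightarrow> nat \<Rightarrow> nat" where
  "gdist E n x y = (LEAST k. (x, y) \<in> (adj_rel E n) ^^ k)"

definition simple_graph :: "(nat \<Rightarrow> nat \<Rightarrow> bool) \<Rightarrow> nat \<Rightarrow> bool" where
  "simple_graph E n \<longleftrightarrow> (\<forall>x<n. \<not> E x x) \<and> (\<forall>x<n. \<forall>y<n. E x y \<longrightarrow> E y x)"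

definition connected_graph :: "(nat \<Rightarrow> nat \<Rightarrow> bool) \<Rightarrow> nat \<Rightarrow> bool" where
  "connected_graph E n \<longleftrightarrow> 0 < n \<and> (\<forall>x<n. \<forall>y<n. \<exists>k. (x, y) \<in> (adj_rel E n) ^^ k)"

definition diameter :: "(nat \<Rightarrow> nat \<Rightarrow> bool) \<Rightarrow> nat \<Rightarrow> nat" where
  "diameter E n = Max {gdist E n x y | x y. x < n \<and> y < n}"

definition distance_regular ::
  "(nat \<Rightarrow> nat \<Rightarrow> bool) \<Rightarrow> nat \<Rightarrow> nat \<Rightarrow> (nat \<Rightarrow> nat) \<Rightarrow> (nat \<Rightarrow> nat) \<Rightarrow> bool" where
  "distance_regular E n D b c \<longleftrightarrow>
     simple_graph E n \<and> connected_graph E n \<and> diameter E n = D \<and>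
     (\<forall>i\<le>D. \<forall>x<n. \<forall>y<n. gdist E n x y = i \<longrightarrow>
        card {z. z < n \<and> E y z \<and> gdist E n x z + 1 = i} = c i \<and>
        card {z. z < n \<and> E y z \<and> gdist E n x z = i + 1} = b i)"

definition intersection_a :: "(nat \<Rightarrow> nat) \<Rightarrow> (nat \<Rightarrow> nat) \<Rightarrow> nat \<Rightarrow> int" where
  "intersection_a b c i = int (b 0) - int (b i) - int (c i)"

definition adj_matrix :: "(nat \<Rightarrow> nat \<Rightarrow> bool) \<Rightarrow> nat \<Rightarrow> real mat" where
  "adj_matrix E n = mat n n (\<lambda>(i, j). if E i j then 1 else 0)"

definition eig_mult :: "real mat \<Rightarrow> real \<Rightarrow> nat" where
  "eig_mult A \<theta> = order \<theta> (char_poly A)"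

end

theory Submission
  imports Defs "Jordan_Normal_Form.Schur_Decomposition"
begin

text \<open>
  Write \<open>a = a 3\<close>, \<open>B = a 3 - a 1\<close> and \<open>s = b 2 + c 2\<close>. The distance matrices express the all-ones
  matrix as a cubic polynomial in the adjacency matrix, whose roots are the eigenvalues other than
  the valency. As \<open>a\<close> is such a root, the valency is \<open>a B\<close>, and the remaining roots \<open>x\<close> and \<open>y\<close> satisfy
  \<open>x + y = a - B - s\<close> and \<open>x y = B b 2 + c 2 - a B\<close>. The traces of the first three powers of the
  adjacency matrix, evaluated with equal multiplicities, force \<open>- 2 B < x + y < 0\<close>, which is (i), and
  yield a polynomial equation between \<open>a\<close>, \<open>B\<close>, \<open>b 2\<close> and \<open>c 2\<close>. Part (ii) follows from (i) because the
  number of vertices at distance 3 from both ends of a pair at distance 3 is non-negative.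
  In (iii), for \<open>b 2 = c 2\<close> the polynomial equation factors, and \<open>a 1 \<ge> 0\<close> leaves only
  \<open>s = a\<close>. For \<open>s = a\<close> it becomes \<open>c 2 (B - 1) N = a^2 B^2\<close> with \<open>N = 2 a (B + 1) + B\<close>; hence \<open>N\<close>
  divides \<open>B^4\<close> and \<open>B - 1\<close> divides \<open>a^2\<close>, and the two divisibilities together give \<open>2 a = B (B - 1)\<close>.
\<close>

section \<open>Diophantine equations\<close>

text \<open>Below, \<open>j\<close> and \<open>l\<close> are the roots of \<open>X^2 - (4 + e q) X + (q^2 - 4 q + 6 + e)\<close> for an integer \<open>e\<close>, and
  the divisibility assumption restricts \<open>4 (e + 1)\<close> to four multiples of \<open>q - 2\<close>.\<close>
lemma shilla_divisor_eq:
  fixes j l q :: int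
  assumes q: "q \<ge> 3" and j: "j \<ge> 1" and l: "l \<ge> 3"
    and prod: "(j * q - 1) * (l * q - 1) = (q - 1) ^ 4"
    and dv: "q - 2 dvd 2 * (j + l) - 4"
  shows "l = q\<^sup>2 - 3 * q + 3"
proof -
  \<comment> \<open>Both sides of \<open>prod\<close> have constant term 1 in \<open>q\<close>;
    after cancelling it a factor \<open>q\<close> can be divided out.\<close>
  have red: "j * l * q - (j + l) = q ^ 3 - 4 * q\<^sup>2 + 6 * q - 4"
  proof -
    have "q * (j * l * q - (j + l)) = q * (q ^ 3 - 4 * q\<^sup>2 + 6 * q - 4)"
      using prod by (simp add: algebra_simps eval_nat_numeral)
    thus ?thesis using q by simp
  qed
  define e where "e = j * l - (q\<^sup>2 - 4 * q + 6)"
  have P: "j * l = q\<^sup>2 - 4 * q + 6 + e" by (simp add: e_def)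
  have S: "j + l = 4 + e * q" using red unfolding e_def by (simp add: algebra_simps eval_nat_numeral)
  have "0 \<le> e * q" using S j l by linarith
  hence e0: "e \<ge> 0" using q by (simp add: zero_le_mult_iff)
  \<comment> \<open>Together with \<open>e0\<close> this confines \<open>e\<close> to the range from
    0 to \<open>q - 3\<close>, so the cofactor \<open>f\<close> below can only be 1, 2, 3 or
    4.\<close>
  have jl1: "(j - 1) * (l - 1) = (q - 1) * (q - 3 - e)" using P S by (simp add: algebra_simps eval_nat_numeral)
  have "0 \<le> (q - 1) * (q - 3 - e)" using j l unfolding jl1[symmetric] by simp
  hence eq3: "e \<le> q - 3" using q by (simp add: zero_le_mult_iff)
  have "2 * (j + l) - 4 = 2 * e * (q - 2) + 4 * (e + 1)" using S by (simp add: algebra_simps eval_nat_numeral)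
  hence "q - 2 dvd 4 * (e + 1)" using dv by (metis dvd_add_right_iff dvd_triv_right)
  then obtain f where f: "4 * (e + 1) = f * (q - 2)" by (metis dvd_def mult.commute)
  have "0 < f * (q - 2)" unfolding f[symmetric] using e0 by simp
  hence f1: "f \<ge> 1" using q by (simp add: zero_less_mult_iff)
  have "f * (q - 2) \<le> 4 * (q - 2)" unfolding f[symmetric] using eq3 by simp
  hence f4: "f \<le> 4" by (rule mult_right_le_imp_le) (use q in simp)
  have jl2: "(j - 2) * (l - 2) = q\<^sup>2 - 4 * q + 2 + e - 2 * e * q" using P S by (simp add: algebra_simps eval_nat_numeral)
  consider "f = 1" | "f = 2" | "f = 3" | "f = 4" using f1 f4 by linarith
  thus ?thesis
  proof cases
    case 1
    hence qe: "q = 4 * e + 6" using f by simp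
    \<comment> \<open>For \<open>e \<ge> 3\<close> the first product is positive and the second
      negative: \<open>j\<close> and \<open>l\<close> lie strictly on the same side of 4 but
      strictly on opposite sides of 5, which is impossible for integers.\<close>
    have j4: "(j - 4) * (l - 4) = 9 * e + 18" using P S unfolding qe by (simp add: algebra_simps eval_nat_numeral)
    have j5: "(j - 5) * (l - 5) = - 4 * e\<^sup>2 + 3 * e + 23" using P S unfolding qe by (simp add: algebra_simps eval_nat_numeral)
    show ?thesis
    proof (cases "e \<ge> 3")
      case True
      have "e * e \<ge> 3 * e" using True by (intro mult_right_mono) auto
      hence neg: "(j - 5) * (l - 5) < 0" using j5 True unfolding power2_eq_square by linarith
      have pos: "(j - 4) * (l - 4) > 0" using j4 True by simp
      show ?thesis
        using neg pos unfolding mult_less_0_iff zero_less_mult_iff by linarith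
    next
      case False
      hence "e = 0 \<or> e = 1 \<or> e = 2" using e0 by linarith
      hence eq: "e = 0 \<and> q = 6 \<or> e = 1 \<and> q = 10 \<or> e = 2 \<and> q = 14" using qe by auto
      \<comment> \<open>For the three small values of \<open>e\<close>, the discriminant of the
        quadratic with roots \<open>j\<close> and \<open>l\<close> is negative or equal to 432,
        which lies strictly between the squares of 20 and 21.\<close>
      define d where "d = (j - l)\<^sup>2"
      have "d = (j + l)\<^sup>2 - 4 * (j * l)" by (simp add: d_def power2_eq_square algebra_simps)
      hence dd: "d = (4 + e * q)\<^sup>2 - 4 * (q\<^sup>2 - 4 * q + 6 + e)" by (simp only: P S)
      have "d = -56 \<or> d = -72 \<or> d = 432"
        using eq by (elim disjE conjE) (simp_all add: dd)
      moreover have "d \<ge> 0" by (simp add: d_def)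
      moreover have "d \<noteq> 432"
      proof
        assume h: "d = 432"
        have "\<bar>j - l\<bar> < 21" by (rule power2_less_imp_less) (use h d_def in simp_all)
        moreover have "20 < \<bar>j - l\<bar>" by (rule power2_less_imp_less) (use h d_def in simp_all)
        ultimately show False by linarith
      qed
      ultimately show ?thesis by linarith
    qed
  next
    case 2
    hence qe: "q = 2 * e + 4" using f by simp
    \<comment> \<open>The positive product forces both roots to be at least 3. Then
      \<open>(j - 3) * (l - 3) \<ge> 0\<close> bounds \<open>e * q\<close> by \<open>e + 3\<close>,
      so \<open>e = 0\<close> and the sum of the roots is only 4.\<close>
    have h: "(j - 2) * (l - 2) = e + 2" using jl2 unfolding qe by (simp add: algebra_simps eval_nat_numeral)
    hence "j > 2" using e0 l by (smt (verit) mult_nonpos_nonneg)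
    hence "0 \<le> (j - 3) * (l - 3)" using l by simp
    moreover have "(j - 3) * (l - 3) = e + 2 - (j + l - 4) + 1" using h by (simp add: algebra_simps eval_nat_numeral)
    ultimately have "e * q \<le> e + 3" using S by linarith
    moreover have "e * q = 2 * e * e + 4 * e" unfolding qe by (simp add: algebra_simps eval_nat_numeral)
    ultimately have "2 * e * e + 3 * e \<le> 3" by linarith
    hence "e = 0" using e0 by (smt (verit) mult_le_cancel_right1 mult_nonneg_nonneg)
    hence "j + l = 4" using S by simp
    hence "j = 1 \<or> j \<le> 0" using l by linarith
    thus ?thesis using \<open>j > 2\<close> by linarith
  next
    case 3
    hence qe: "4 * e = 3 * q - 10" using f by simp
    \<comment> \<open>The right-hand side is negative for \<open>q \<ge> 4\<close>, which forces
      \<open>j = 1\<close> and hence \<open>e = q - 3\<close>; this contradicts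
      \<open>qe\<close>.\<close>
    have "4 * ((j - 2) * (l - 2)) = - 2 * q\<^sup>2 + 7 * q - 2" using jl2 qe arg_cong[OF qe, of "\<lambda>x. x * q"] by (simp add: algebra_simps eval_nat_numeral)
    moreover have "q \<ge> 4" using qe e0 by linarith
    moreover have "q * q \<ge> 4 * q" using \<open>q \<ge> 4\<close> by (intro mult_right_mono) auto
    ultimately have "(j - 2) * (l - 2) < 0" unfolding power2_eq_square by linarith
    hence "j = 1" using j l by (auto simp: mult_less_0_iff)
    hence "(q - 1) * (q - 3 - e) = 0" using jl1 by simp
    hence "e = q - 3" using q by auto
    thus ?thesis using qe q by linarith
  next
    case 4
    \<comment> \<open>This is the only surviving case: \<open>e\<close> takes its extreme value, one
      root is 1, and the other is the product of the roots.\<close>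
    hence e: "e = q - 3" using f by simp
    hence "(j - 1) * (l - 1) = 0" using jl1 by simp
    hence "j = 1" using l by auto
    thus ?thesis using P e by (simp add: power2_eq_square algebra_simps)
  qed
qed

text \<open>This settles \<open>b 2 + c 2 = a 3\<close>. The complementary divisor \<open>M\<close>
  of \<open>b ^ 4\<close> by \<open>N\<close> is congruent to -1 modulo \<open>b + 1\<close>, as
  \<open>N\<close> is, so both have the shape required by \<open>shilla_divisor_eq\<close> with
  \<open>q = b + 1\<close> and \<open>l = 2 * a + 1\<close>.\<close>

lemma shilla_sum_eq:
  fixes a b c :: int
  assumes a: "a > 0" and b: "b \<ge> 2"
    and eq: "c * (b - 1) * (2 * a * (b + 1) + b) = a\<^sup>2 * b\<^sup>2"
  shows "2 * a = b * (b - 1)"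
proof -
  define N where "N = 2 * a * (b + 1) + b"
  have N0: "N > 0" using a b by (simp add: N_def add_pos_pos)
  have "N dvd a\<^sup>2 * b\<^sup>2" using eq by (metis N_def dvd_triv_right)
  hence "N dvd 4 * (b + 1)\<^sup>2 * (a\<^sup>2 * b\<^sup>2)" by simp
  \<comment> \<open>Modulo \<open>N\<close> one has \<open>2 * a * (b + 1) = - b\<close>, so the
    factor \<open>4 * (b + 1)\<^sup>2\<close> turns \<open>a\<^sup>2 * b\<^sup>2\<close> into
    \<open>b ^ 4\<close>.\<close>
  moreover have "4 * (b + 1)\<^sup>2 * (a\<^sup>2 * b\<^sup>2) = N * (b\<^sup>2 * (N - 2 * b)) + b ^ 4"
    unfolding N_def by (simp add: algebra_simps eval_nat_numeral)
  ultimately have "N dvd b ^ 4" by (metis dvd_add_right_iff dvd_triv_left)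
  then obtain M where NM: "b ^ 4 = N * M" by (auto simp: dvd_def)
  have M0: "M > 0" using NM N0 b by (metis zero_less_mult_iff zero_less_power not_less_iff_gr_or_eq order.strict_trans2 zero_less_numeral)
  \<comment> \<open>Modulo \<open>b + 1\<close>, \<open>N\<close> is -1 and
    \<open>b ^ 4 = N * M\<close> is 1.\<close>
  have "b + 1 dvd M + 1"
  proof -
    have "M + 1 = (b + 1) * (2 * a * M + M) - (N * M - 1)" unfolding N_def by (simp add: algebra_simps)
    also have "N * M - 1 = (b + 1) * ((b - 1) * (b\<^sup>2 + 1))" unfolding NM[symmetric] by (simp add: algebra_simps eval_nat_numeral)
    finally have "M + 1 = (b + 1) * (2 * a * M + M - (b - 1) * (b\<^sup>2 + 1))" by (simp add: right_diff_distrib)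
    thus ?thesis by simp
  qed
  then obtain j where j: "M = j * (b + 1) - 1" by (metis add_diff_cancel_right' dvd_def mult.commute)
  have "0 < j * (b + 1)" using j M0 by linarith
  hence j1: "j \<ge> 1" using b by (simp add: zero_less_mult_iff)
  have cop: "coprime (b - 1) (b\<^sup>2)"
    by (simp add: coprime_iff_gcd_eq_1 gcd_diff1 flip: coprime_iff_gcd_eq_1) 
  have "b - 1 dvd a\<^sup>2 * b\<^sup>2" using eq by (metis dvd_triv_right dvd_mult2)
  hence a2: "b - 1 dvd a\<^sup>2" using cop by (simp add: coprime_dvd_mult_left_iff)
  \<comment> \<open>Modulo \<open>b - 1\<close>, \<open>N\<close> is \<open>4 * a + 1\<close> and
    \<open>N * M\<close> is 1. Since \<open>a\<^sup>2\<close> vanishes, the inverse of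
    \<open>4 * a + 1\<close> is \<open>1 - 4 * a\<close>, so \<open>M + N\<close> is 2. On the other
    hand \<open>M + N\<close> is \<open>2 * (j + (2 * a + 1)) - 2\<close>.\<close>
  have "b - 1 dvd 2 * (j + (2 * a + 1)) - 4"
  proof -
    have "M + N = (b + 1) * (j + (2 * a + 1)) - 2" unfolding j N_def by (simp add: algebra_simps)
    moreover have "b - 1 dvd M + N - 2"
    proof -
      have "(4 * a + 1) * M - 1 = (b ^ 4 - 1) - (b - 1) * ((2 * a + 1) * M)"
        unfolding NM N_def by (simp add: algebra_simps)
      also have "\<dots> = (b - 1) * ((b + 1) * (b\<^sup>2 + 1) - (2 * a + 1) * M)" by (simp add: algebra_simps eval_nat_numeral)
      finally have "b - 1 dvd (4 * a + 1) * M - 1" by simp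
      hence "b - 1 dvd (1 - 4 * a) * ((4 * a + 1) * M - 1) + 16 * M * a\<^sup>2" using a2 by simp
      moreover have "M + N - 2 = ((1 - 4 * a) * ((4 * a + 1) * M - 1) + 16 * M * a\<^sup>2) + (b - 1) * (2 * a + 1)"
        unfolding N_def by (simp add: algebra_simps power2_eq_square)
      ultimately show ?thesis by (metis dvd_add dvd_triv_left)
    qed
    moreover have "2 * (j + (2 * a + 1)) - 4 = ((b + 1) * (j + (2 * a + 1)) - 2 - 2) - (b - 1) * (j + (2 * a + 1))"
      by (simp add: algebra_simps)
    ultimately show ?thesis by (metis dvd_diff dvd_triv_left)
  qed
  moreover have "(2 * a + 1) * (b + 1) - 1 = N" unfolding N_def by (simp add: algebra_simps)
  hence "(j * (b + 1) - 1) * ((2 * a + 1) * (b + 1) - 1) = b ^ 4"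
    using NM j by (simp add: mult.commute)
  ultimately have "2 * a + 1 = (b + 1)\<^sup>2 - 3 * (b + 1) + 3"
    using shilla_divisor_eq[of "b + 1" j "2 * a + 1"] j1 a b by simp
  thus ?thesis by (simp add: power2_eq_square algebra_simps)
qed

text \<open>This settles \<open>b 2 = c 2\<close>, with \<open>t = a 3 - b 2 - c 2\<close>; the
  hypothesis \<open>a \<ge> b\<close> is \<open>a 1 \<ge> 0\<close>. A positive \<open>t\<close>
  makes the left-hand side of \<open>eq\<close> too large, a negative \<open>t\<close> makes it
  non-positive while the right-hand side stays positive, and \<open>t = 0\<close> is the
  claim.\<close>

lemma shilla_diff_eq:
  fixes a b c t :: int
  assumes a: "a \<ge> b" and b: "b \<ge> 2" and t: "\<bar>t\<bar> < b"
    and eq: "2 * a * (1 + b * t) = 2 * t\<^sup>2 + (3 - b) * t + b * (b - 1)"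
  shows "2 * a = b * (b - 1)"
proof -
  consider "t = 0" | "t \<ge> 1" | "t \<le> -1" by linarith
  thus ?thesis
  proof cases
    case 1 thus ?thesis using eq by simp
  next
    case 2
    have "a * (1 + b * t) \<ge> b * (1 + b * t)" using a b 2 by (intro mult_right_mono) auto
    hence "2 * b + 2 * (b * (b * t)) \<le> 2 * (t * t) + 3 * t - b * t + b * b - b"
      using eq by (simp add: algebra_simps power2_eq_square)
    moreover have "b * (b * t) \<ge> b * b" using 2 b by simp
    moreover have "b * (t * t) \<le> b * (b * t)" using 2 b t by (simp add: mult_left_mono mult_right_mono)
    moreover have "2 * (t * t) \<le> b * (t * t)" using b by (intro mult_right_mono) auto
    moreover have "b * t \<ge> b" using 2 b by simp
    ultimately have False using t 2 b by linarith
    thus ?thesis ..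
  next
    case 3
    have "b * t \<le> b * (-1)" using 3 b by (intro mult_left_mono) auto
    hence "a * (1 + b * t) \<le> 0" using a b by (intro mult_nonneg_nonpos) auto
    hence "2 * (t * t) + 3 * t - b * t + b * b - b \<le> 0"
      using eq by (simp add: algebra_simps power2_eq_square)
    moreover have "t * t \<ge> - t" using 3 mult_right_mono_neg[of t "-1" t] by simp
    moreover have "b * t \<le> 2 * t" using 3 b by (intro mult_right_mono_neg) auto
    moreover have "b * b > b" using b by simp
    ultimately have False using 3 by linarith
    thus ?thesis ..
  qed
qed

text \<open>The hypotheses are the traces of the powers 0 to 3 for the spectrum \<open>K\<close>,
  \<open>a\<close>, \<open>x\<close>, \<open>y\<close> with multiplicities 1, \<open>m1\<close>,
  \<open>m\<close>, \<open>m\<close>. Polynomials vanishing at \<open>K\<close> and \<open>a\<close>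
  eliminate \<open>m1\<close>; two of them give two expressions for \<open>m\<close>, and comparing
  these eliminates \<open>m\<close> and \<open>n\<close>.\<close>

lemma equal_multiplicities:
  fixes x y a B K n m m1 :: real
  assumes T0: "1 + m1 + 2 * m = n"
    and T1: "K + m1 * a + m * (x + y) = 0"
    and T2: "K\<^sup>2 + m1 * a\<^sup>2 + m * (x\<^sup>2 + y\<^sup>2) = n * K"
    and T3: "K ^ 3 + m1 * a ^ 3 + m * (x ^ 3 + y ^ 3) = n * K * (a - B)"
    and K: "K = a * B" and pos: "a > 0" "B > 0" "n > 0" "m \<ge> 0" "m1 \<ge> 0" and xy: "x \<noteq> y"
  shows "x + y < 0" "0 < 2 * B + (x + y)"
    "((x + y)\<^sup>2 - 4 * (x * y)) * (K + a - (x + y)) =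
      (2 * B + (x + y)) * ((x + y)\<^sup>2 - 2 * (x * y) - (K + a) * (x + y) + 2 * K * a)"
proof -
  let ?s = "x + y" and ?F = "(x + y)\<^sup>2 - 2 * (x * y) - (K + a) * (x + y) + 2 * K * a"
  have K0: "K > 0" using K pos by simp
  have "K + m1 * a > 0" using K0 pos by (simp add: add_pos_nonneg)
  hence ms: "m * ?s < 0" using T1 by linarith
  show neg: "?s < 0" using ms pos(4) by (auto simp: mult_less_0_iff)
  have m0: "m > 0" using ms pos(4) by (auto simp: mult_less_0_iff)
  \<comment> \<open>This is the sum of \<open>(X - K) * (X - a)\<close> over the spectrum, where
    only \<open>x\<close> and \<open>y\<close> contribute.\<close>
  have "m * ?F = (K\<^sup>2 + m1 * a\<^sup>2 + m * (x\<^sup>2 + y\<^sup>2)) - (K + a) * (K + m1 * a + m * (x + y))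
      + K * a * (1 + m1 + 2 * m)"
    by (simp add: algebra_simps power2_eq_square)
  also have "\<dots> = n * K * (1 + a)" unfolding T0 T1 T2 by (simp add: algebra_simps)
  finally have mF: "m * ?F = n * K * (1 + a)" .
  \<comment> \<open>This is the sum of \<open>(X - K) * (X - a) * (2 * X - (x + y))\<close> over the
    spectrum. The last factor is \<open>x - y\<close> at \<open>x\<close> and \<open>y - x\<close>
    at \<open>y\<close>, which produces the square and hence a definite sign.\<close>
  have "m * ((x - y)\<^sup>2 * (?s - K - a)) =
      2 * (K ^ 3 + m1 * a ^ 3 + m * (x ^ 3 + y ^ 3))
      - (2 * K + 2 * a + ?s) * (K\<^sup>2 + m1 * a\<^sup>2 + m * (x\<^sup>2 + y\<^sup>2))
      + (2 * K * a + (K + a) * ?s) * (K + m1 * a + m * (x + y))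
      - K * a * ?s * (1 + m1 + 2 * m)"
    by (simp add: algebra_simps eval_nat_numeral)
  also have "\<dots> = - (n * K * (1 + a) * (2 * B + ?s))"
    unfolding T0 T1 T2 T3 using K by (simp add: algebra_simps)
  finally have mD: "m * ((x - y)\<^sup>2 * (K + a - ?s)) = n * K * (1 + a) * (2 * B + ?s)"
    by (simp add: algebra_simps)
  have "m * ((x - y)\<^sup>2 * (K + a - ?s)) > 0" using m0 xy K0 pos neg by simp
  hence "0 < n * K * (1 + a) * (2 * B + ?s)" unfolding mD .
  moreover have "0 < n * K * (1 + a)" using pos K0 by simp
  ultimately show "0 < 2 * B + ?s" by (simp only: zero_less_mult_pos)
  have "m * ((x - y)\<^sup>2 * (K + a - ?s)) = m * ((2 * B + ?s) * ?F)"
    unfolding mD mF[symmetric] by (simp only: mult_ac)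
  hence "(x - y)\<^sup>2 * (K + a - ?s) = (2 * B + ?s) * ?F" using m0 by simp
  moreover have "(x - y)\<^sup>2 = (x + y)\<^sup>2 - 4 * (x * y)" by (simp add: power2_eq_square algebra_simps)
  ultimately show "((x + y)\<^sup>2 - 4 * (x * y)) * (K + a - ?s) = (2 * B + ?s) * ?F" by simp
qed

lemma monic_quadratic_sum_prod:
  fixes x y p q :: real
  assumes "x\<^sup>2 + p * x + q = 0" "y\<^sup>2 + p * y + q = 0" "x \<noteq> y"
  shows "x + y = - p" "x * y = q"
proof -
  have "(x - y) * (x + y + p) = 0" using assms(1,2) by (simp add: algebra_simps power2_eq_square)
  thus s: "x + y = - p" using assms(3) by simp
  hence p: "p = - x - y" by simp
  show "x * y = q" using assms(1) unfolding p by (simp add: algebra_simps power2_eq_square)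
qed

text \<open>Here \<open>t - B\<close> and \<open>p\<close> are the sum and the product of the two
  smallest eigenvalues, and \<open>eq\<close> is the equation from
  \<open>equal_multiplicities\<close>. Each alternative in \<open>cases\<close> expresses
  \<open>p\<close> without \<open>b2\<close> and reduces \<open>eq\<close> to one of the Diophantine
  equations above.\<close>

lemma shilla_integer_cases:
  fixes a B b2 c2 t p :: int
  assumes a: "a > 0" "a \<ge> B" and B: "B \<ge> 2" and c2: "c2 > 0"
    and t: "t = a - b2 - c2" "\<bar>t\<bar> < B"
    and p: "p = (B - 1) * (b2 - a) - t"
    and eq: "((t - B)\<^sup>2 - 4 * p) * (a * B + a - (t - B)) =
      (t + B) * ((t - B)\<^sup>2 - 2 * p - (a * B + a) * (t - B) + 2 * (a * B) * a)"
    and cases: "b2 + c2 = a \<or> b2 = c2"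
  shows "2 * a = B * (B - 1)"
  using cases
proof
  assume "b2 + c2 = a"
  hence b2: "b2 = a - c2" and t0: "t = 0" and p0: "p = - ((B - 1) * c2)"
    using t p by (auto simp: algebra_simps)
  have "c2 * (B - 1) * (2 * a * (B + 1) + B) = a\<^sup>2 * B\<^sup>2"
    using eq unfolding t0 p0 by (simp add: algebra_simps power2_eq_square)
  thus ?thesis using shilla_sum_eq a(1) B by blast
next
  assume "b2 = c2"
  hence a_t: "a = t + 2 * c2" and b2: "b2 = c2" using t by auto
  \<comment> \<open>Since \<open>b2\<close> is half of \<open>a - t\<close>, doubling
    \<open>p\<close> keeps everything integral. Substitution then leaves the factor
    \<open>a - t\<close>, which equals \<open>2 * c2\<close> and can be cancelled.\<close>
  have p': "2 * p = - (B - 1) * (a + t) - 2 * t"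
    unfolding p b2 a_t by (simp add: algebra_simps)
  have "4 * p = 2 * (2 * p)" by simp
  hence eq': "((t - B)\<^sup>2 - 2 * (- (B - 1) * (a + t) - 2 * t)) * (a * B + a - (t - B)) =
      (t + B) * ((t - B)\<^sup>2 - (- (B - 1) * (a + t) - 2 * t) - (a * B + a) * (t - B) + 2 * (a * B) * a)"
    using eq by (simp only: p')
  have "(a - t) * (2 * a * (1 + B * t) - (2 * t\<^sup>2 + (3 - B) * t + B * (B - 1))) = 0"
    using eq' by (simp add: algebra_simps power2_eq_square)
  moreover have "a - t \<noteq> 0" using a_t c2 by simp
  ultimately have "2 * a * (1 + B * t) = 2 * t\<^sup>2 + (3 - B) * t + B * (B - 1)" by simp
  thus ?thesis using shilla_diff_eq a(2) B t(2) by blast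
qed

text \<open>If \<open>c2\<close> were at least \<open>b2 + B\<close>, then \<open>p333\<close> would
  force \<open>b2 > a + 1\<close>, and \<open>b2 + c2\<close> would exceed the bound
  \<open>a + B\<close>.\<close>

lemma shilla_c2_less:
  fixes a B b2 c2 :: int
  assumes p333: "(a + 1) * c2 \<le> (a + B) * b2" and sum: "b2 + c2 < a + B"
    and a: "a > 0" and B: "B \<ge> 2"
  shows "c2 < b2 + B"
proof (rule ccontr)
  assume "\<not> c2 < b2 + B"
  hence ge: "b2 + B \<le> c2" by simp
  hence "(a + 1) * (b2 + B) \<le> (a + 1) * c2" using a by (intro mult_left_mono) auto
  hence "(a + 1) * B \<le> (B - 1) * b2" using p333 by (simp add: algebra_simps)
  moreover have "(a + 1) * (B - 1) < (a + 1) * B" using a by simp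
  ultimately have "(B - 1) * (a + 1) < (B - 1) * b2" by (simp add: mult.commute)
  hence "a + 1 < b2" using B by simp
  thus False using ge sum a by linarith
qed

section \<open>Traces of powers of real symmetric matrices\<close>

definition mtrace :: "'a::comm_ring_1 mat \<Rightarrow> 'a" where
  "mtrace A = (\<Sum>i<dim_row A. A $$ (i, i))"

lemma mtrace_mult_commute:
  assumes A: "A \<in> carrier_mat n n" and B: "B \<in> carrier_mat n n"
  shows "mtrace (A * B) = mtrace (B * A)"
proof -
  have "mtrace (A * B) = (\<Sum>i<n. \<Sum>j<n. A $$ (i, j) * B $$ (j, i))"
    using A B by (simp add: mtrace_def scalar_prod_def lessThan_atLeast0)
  also have "\<dots> = (\<Sum>j<n. \<Sum>i<n. B $$ (j, i) * A $$ (i, j))"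
    by (subst sum.swap) (simp add: mult.commute)
  also have "\<dots> = mtrace (B * A)"
    using A B by (simp add: mtrace_def scalar_prod_def lessThan_atLeast0)
  finally show ?thesis .
qed

lemma mtrace_similar:
  assumes "similar_mat_wit A B P Q"
  shows "mtrace A = mtrace B"
proof -
  define n where "n = dim_row A"
  note w = similar_mat_witD[OF n_def assms]
  have "mtrace A = mtrace (P * (B * Q))" using w by (simp add: assoc_mult_mat)
  also have "\<dots> = mtrace ((B * Q) * P)" using w by (intro mtrace_mult_commute) auto
  also have "(B * Q) * P = B" using w by (simp add: assoc_mult_mat)
  finally show ?thesis .
qed

lemma upper_triangular_mult:
  fixes A B :: "'a::comm_ring_1 mat"
  assumes A: "A \<in> carrier_mat n n" "upper_triangular A"
    and B: "B \<in> carrier_mat n n" "upper_triangular B"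
  shows "upper_triangular (A * B)"
    and "i < n \<Longrightarrow> (A * B) $$ (i, i) = A $$ (i, i) * B $$ (i, i)"
proof -
  have zero: "A $$ (i, k) * B $$ (k, j) = 0" if "i < n" "k < n" "j \<le> i" "k \<noteq> i \<or> j < i" for i j k
    using that upper_triangularD[OF A(2)] upper_triangularD[OF B(2)] A(1) B(1)
    by (cases "k < i") (auto simp: not_less)
  show "upper_triangular (A * B)"
  proof (rule upper_triangularI)
    fix i j assume "j < i" "i < dim_row (A * B)"
    thus "(A * B) $$ (i, j) = 0"
      using A(1) B(1) by (auto simp: scalar_prod_def intro!: sum.neutral zero)
  qed
  assume i: "i < n"
  have "(A * B) $$ (i, i) = (\<Sum>k<n. A $$ (i, k) * B $$ (k, i))"
    using A(1) B(1) i by (simp add: scalar_prod_def lessThan_atLeast0)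
  also have "\<dots> = (\<Sum>k\<in>{i}. A $$ (i, k) * B $$ (k, i))"
    using i zero[of i _ i] by (intro sum.mono_neutral_right) auto
  finally show "(A * B) $$ (i, i) = A $$ (i, i) * B $$ (i, i)" by simp
qed

lemma upper_triangular_pow:
  fixes A :: "'a::comm_ring_1 mat"
  assumes A: "A \<in> carrier_mat n n" "upper_triangular A"
  shows "upper_triangular (A ^\<^sub>m k) \<and> (\<forall>i<n. (A ^\<^sub>m k) $$ (i, i) = A $$ (i, i) ^ k)"
proof (induction k)
  case 0
  thus ?case using A by (auto intro!: upper_triangularI)
next
  case (Suc k)
  have "A ^\<^sub>m k \<in> carrier_mat n n" using A(1) by simp
  from upper_triangular_mult[OF this _ A] Suc show ?case by (simp add: mult.commute)
qed

text \<open>A Schur decomposition makes the matrix similar to a triangular one with diagonal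
  \<open>es\<close>; powers preserve both the similarity and the triangular form.\<close>

lemma mtrace_pow_eq_sum_list:
  fixes A :: "'a::conjugatable_ordered_field mat"
  assumes A: "A \<in> carrier_mat n n" and cp: "char_poly A = (\<Prod>e\<leftarrow>es. [:- e, 1:])"
  shows "mtrace (A ^\<^sub>m k) = (\<Sum>e\<leftarrow>es. e ^ k)"
proof -
  obtain B P Q where BPQ: "schur_decomposition A es = (B, P, Q)"
    by (cases "schur_decomposition A es")
  from schur_decomposition[OF A cp BPQ]
  have wit: "similar_mat_wit A B P Q" and ut: "upper_triangular B" and diag: "diag_mat B = es" by auto
  have B: "B \<in> carrier_mat n n" using similar_mat_witD2[OF A wit] by simp
  have "mtrace (A ^\<^sub>m k) = mtrace (B ^\<^sub>m k)"
    by (rule mtrace_similar[OF similar_mat_wit_pow[OF wit]])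
  also have "\<dots> = (\<Sum>i<n. B $$ (i, i) ^ k)"
    using upper_triangular_pow[OF B ut, of k] B by (simp add: mtrace_def)
  also have "\<dots> = (\<Sum>e\<leftarrow>es. e ^ k)"
    using B unfolding diag[symmetric] diag_mat_def
    by (simp add: sum_list_sum_nth lessThan_atLeast0)
  finally show ?thesis .
qed

text \<open>The characteristic polynomial splits over the complex numbers, and symmetry makes every
  root real. The factorization then descends because the embedding of real polynomials into complex
  ones is injective.\<close>

lemma char_poly_symmetric_real_splits:
  fixes A :: "real mat"
  assumes A: "A \<in> carrier_mat n n"
    and sym: "\<And>i j. i < n \<Longrightarrow> j < n \<Longrightarrow> A $$ (i, j) = A $$ (j, i)"
  shows "\<exists>es. char_poly A = (\<Prod>e\<leftarrow>es. [:- e, 1:])"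
proof -
  interpret hp: map_poly_inj_idom_hom complex_of_real ..
  let ?C = "map_mat complex_of_real A"
  have C: "?C \<in> carrier_mat n n" using A by simp
  obtain as where cp: "char_poly ?C = (\<Prod>a\<leftarrow>as. [:- a, 1:])"
    using char_poly_factorized[OF C] by blast
  have real: "complex_of_real (Re a) = a" if "a \<in> set as" for a
  proof -
    have "poly (char_poly ?C) a = 0" using that unfolding cp poly_prod_list_zero_iff by force
    hence "eigenvalue ?C a" using eigenvalue_root_char_poly[OF C] by simp
    then obtain v where v: "v \<in> carrier_vec n" "v \<noteq> 0\<^sub>v n" "?C *\<^sub>v v = a \<cdot>\<^sub>v v"
      using C unfolding eigenvalue_def eigenvector_def by auto
    have row: "(\<Sum>j<n. of_real (A $$ (i, j)) * v $ j) = a * v $ i" if "i < n" for i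
      using arg_cong[OF v(3), of "\<lambda>w. w $ i"] that A v(1)
      by (simp add: scalar_prod_def lessThan_atLeast0)
    \<comment> \<open>\<open>N\<close> is the squared Hermitian norm of the eigenvector. The form in
      \<open>aN\<close> is invariant under conjugation by symmetry, so \<open>a * N\<close> is real;
      as \<open>N\<close> is real and nonzero, \<open>a\<close> is real.\<close>
    define N where "N = (\<Sum>i<n. cnj (v $ i) * v $ i)"
    have aN: "a * N = (\<Sum>i<n. \<Sum>j<n. cnj (v $ i) * of_real (A $$ (i, j)) * v $ j)"
      unfolding N_def sum_distrib_left
    proof (intro sum.cong refl)
      fix i assume "i \<in> {..<n}"
      hence "a * (cnj (v $ i) * v $ i) = cnj (v $ i) * (\<Sum>j<n. of_real (A $$ (i, j)) * v $ j)"
        by (simp add: row)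
      thus "a * (cnj (v $ i) * v $ i) = (\<Sum>j<n. cnj (v $ i) * of_real (A $$ (i, j)) * v $ j)"
        by (simp add: sum_distrib_left mult.assoc)
    qed
    have "cnj (a * N) = (\<Sum>i<n. \<Sum>j<n. v $ i * of_real (A $$ (i, j)) * cnj (v $ j))"
      unfolding aN by simp
    also have "\<dots> = (\<Sum>j<n. \<Sum>i<n. cnj (v $ j) * of_real (A $$ (j, i)) * v $ i)"
      by (subst sum.swap, intro sum.cong refl) (simp add: sym mult_ac)
    also have "\<dots> = a * N" by (simp add: aN)
    finally have eq: "cnj a * cnj N = a * N" by simp
    define r where "r = (\<Sum>i<n. (cmod (v $ i))\<^sup>2)"
    have Nr: "N = of_real r"
      unfolding N_def r_def of_real_sum by (simp only: complex_norm_square mult.commute)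
    obtain i where "i < n" "v $ i \<noteq> 0"
      using v(1,2) by (metis eq_vecI carrier_vecD index_zero_vec)
    hence "r > 0" unfolding r_def by (intro sum_pos2[of _ i]) auto
    hence "cnj N = N" "N \<noteq> 0" using Nr by auto
    with eq have "cnj a = a" by simp
    thus ?thesis by (metis Reals_cnj_iff of_real_Re)
  qed
  have "map_poly complex_of_real (\<Prod>e\<leftarrow>map Re as. [:- e, 1:]) = (\<Prod>a\<leftarrow>as. [:- a, 1:])"
    using real
  proof (induction as)
    case (Cons a as)
    have "map_poly complex_of_real [:- Re a, 1:] = [:- a, 1:]" using Cons.prems[of a] by simp
    hence "map_poly complex_of_real ([:- Re a, 1:] * p) = [:- a, 1:] * map_poly complex_of_real p" for p
      by (simp only: hp.hom_mult)
    thus ?case using Cons by (simp only: list.map prod_list.Cons list.set_intros simp_thms)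
  qed simp
  also have "\<dots> = map_poly complex_of_real (char_poly A)"
    unfolding cp[symmetric] by (rule of_real_hom.char_poly_hom[OF A])
  finally have "char_poly A = (\<Prod>e\<leftarrow>map Re as. [:- e, 1:])" by (metis hp.eq_iff)
  thus ?thesis by blast
qed

lemma order_prod_list_linear:
  "Polynomial.order x (\<Prod>e\<leftarrow>es. [:- e, 1:]) = count_list es (x::'a::field)"
proof (induction es)
  case (Cons e es)
  have "(\<Prod>e\<leftarrow>es. [:- e, 1:]) \<noteq> 0" by (auto simp: prod_list_zero_iff)
  hence nz: "[:- e, 1:] * (\<Prod>e\<leftarrow>es. [:- e, 1:]) \<noteq> 0"
    by (simp only: mult_eq_0_iff) simp
  have "Polynomial.order x [:- e, 1:] = (if e = x then 1 else 0)"
    using order_power_n_n[of x 1] by (auto simp: order_0I)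
  thus ?case using Cons order_mult[OF nz] by simp
qed simp

lemma sum_list_eq_sum_count_list:
  fixes f :: "'a \<Rightarrow> 'b::comm_semiring_1"
  assumes "finite X" "set es \<subseteq> X"
  shows "(\<Sum>e\<leftarrow>es. f e) = (\<Sum>x\<in>X. of_nat (count_list es x) * f x)"
  using assms(2)
proof (induction es)
  case (Cons e es)
  have "of_nat (count_list (e # es) x) * f x =
      of_nat (count_list es x) * f x + (if x = e then f x else 0)" for x
    by (cases "x = e") (simp_all add: distrib_right add.commute)
  hence "(\<Sum>x\<in>X. of_nat (count_list (e # es) x) * f x) =
      (\<Sum>x\<in>X. of_nat (count_list es x) * f x) + (\<Sum>x\<in>X. if x = e then f x else 0)"
    by (simp only: sum.distrib)
  thus ?case using Cons assms(1) by (simp del: count_list.simps add: add.commute)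
qed simp

text \<open>This links the algebraic multiplicities in \<open>eig_mult\<close> to the traces, which
  the graph determines by counting closed walks.\<close>

lemma mtrace_pow_symmetric:
  fixes A :: "real mat"
  assumes A: "A \<in> carrier_mat n n"
    and sym: "\<And>i j. i < n \<Longrightarrow> j < n \<Longrightarrow> A $$ (i, j) = A $$ (j, i)"
  shows "mtrace (A ^\<^sub>m k) = (\<Sum>x | eigenvalue A x. real (eig_mult A x) * x ^ k)"
proof -
  obtain es where es: "char_poly A = (\<Prod>e\<leftarrow>es. [:- e, 1:])"
    using char_poly_symmetric_real_splits[OF A sym] by blast
  have ev: "{x. eigenvalue A x} = set es"
    unfolding eigenvalue_root_char_poly[OF A] es poly_prod_list_zero_iff by force
  have "(\<Sum>e\<leftarrow>es. e ^ k) = (\<Sum>x\<in>set es. real (count_list es x) * x ^ k)"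
    by (rule sum_list_eq_sum_count_list) auto
  thus ?thesis
    unfolding mtrace_pow_eq_sum_list[OF A es] ev eig_mult_def es order_prod_list_linear .
qed

section \<open>Distance-regular graphs of diameter three\<close>

locale drg3 =
  fixes E :: "nat \<Rightarrow> nat \<Rightarrow> bool" and n :: nat and b c :: "nat \<Rightarrow> nat"
  assumes drg: "distance_regular E n 3 b c"
begin

section \<open>Graph distance\<close>

abbreviation d :: "nat \<Rightarrow> nat \<Rightarrow> nat" where "d \<equiv> gdist E n"

lemma irrefl: "x < n \<Longrightarrow> \<not> E x x"
  and sym: "x < n \<Longrightarrow> y < n \<Longrightarrow> E x y \<Longrightarrow> E y x"
  and connected: "x < n \<Longrightarrow> y < n \<Longrightarrow> \<exists>k. (x, y) \<in> adj_rel E n ^^ k"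
  and n_pos: "n > 0"
  and diam: "diameter E n = 3"
  using drg unfolding distance_regular_def simple_graph_def connected_graph_def by blast+

lemma card_c: "x < n \<Longrightarrow> y < n \<Longrightarrow> d x y = i \<Longrightarrow> i \<le> 3 \<Longrightarrow>
    card {z. z < n \<and> E y z \<and> d x z + 1 = i} = c i"
  and card_b: "x < n \<Longrightarrow> y < n \<Longrightarrow> d x y = i \<Longrightarrow> i \<le> 3 \<Longrightarrow>
    card {z. z < n \<and> E y z \<and> d x z = i + 1} = b i"
  using drg unfolding distance_regular_def by blast+

lemma dist_path: "x < n \<Longrightarrow> y < n \<Longrightarrow> (x, y) \<in> adj_rel E n ^^ d x y"
  unfolding gdist_def by (rule LeastI_ex) (rule connected)

lemma dist_le: "(x, y) \<in> adj_rel E n ^^ k \<Longrightarrow> d x y \<le> k"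
  unfolding gdist_def by (rule Least_le)

lemma path_sym: "(x, y) \<in> adj_rel E n ^^ k \<Longrightarrow> (y, x) \<in> adj_rel E n ^^ k"
proof (induction k arbitrary: x y)
  case (Suc k)
  then obtain z where "(x, z) \<in> adj_rel E n ^^ k" "(z, y) \<in> adj_rel E n" by auto
  hence "(z, x) \<in> adj_rel E n ^^ k" "(y, z) \<in> adj_rel E n"
    using Suc.IH sym by (auto simp: adj_rel_def)
  thus ?case by (rule relpow_Suc_I2[rotated])
qed simp

lemma dist_sym: "x < n \<Longrightarrow> y < n \<Longrightarrow> d x y = d y x"
  using dist_le[OF path_sym[OF dist_path[of x y]]] dist_le[OF path_sym[OF dist_path[of y x]]]
  by (intro antisym)

lemma dist_refl: "d x x = 0"
  using dist_le[of x x 0] by simp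

lemma dist_eq_0_iff: "x < n \<Longrightarrow> y < n \<Longrightarrow> d x y = 0 \<longleftrightarrow> x = y"
  using dist_path[of x y] by (auto simp: dist_refl)

lemma dist_step: "x < n \<Longrightarrow> y < n \<Longrightarrow> z < n \<Longrightarrow> E y z \<Longrightarrow> d x z \<le> d x y + 1"
  using dist_le[OF relpow_Suc_I[OF dist_path[of x y]], of z] by (simp add: adj_rel_def)

lemma dist_step': "x < n \<Longrightarrow> y < n \<Longrightarrow> z < n \<Longrightarrow> E y z \<Longrightarrow> d x y \<le> d x z + 1"
  using dist_step[of x z y] sym by blast

lemma dist_eq_1_iff: "x < n \<Longrightarrow> y < n \<Longrightarrow> d x y = 1 \<longleftrightarrow> E x y"
proof
  assume xy: "x < n" "y < n" and "d x y = 1"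
  thus "E x y" using dist_path[of x y] by (auto simp: adj_rel_def)
next
  assume xy: "x < n" "y < n" and e: "E x y"
  hence "d x y \<le> 1" using dist_step[of x x y] by (simp add: dist_refl)
  moreover have "d x y \<noteq> 0" using xy e irrefl dist_eq_0_iff by auto
  ultimately show "d x y = 1" by simp
qed

lemma dist_pred:
  assumes xy: "x < n" "y < n" and di: "d x y = Suc i"
  obtains z where "z < n" "E z y" "d x z = i"
proof -
  obtain z where "(x, z) \<in> adj_rel E n ^^ i" and zy: "(z, y) \<in> adj_rel E n"
    using dist_path[OF xy] di by auto
  hence "d x z \<le> i" "z < n" "E z y" using dist_le by (auto simp: adj_rel_def)
  thus ?thesis using that dist_step[of x z y] xy di by simp
qed

lemma finite_dists: "finite {d x y | x y. x < n \<and> y < n}"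
  by (rule finite_subset[of _ "(\<lambda>(x, y). d x y) ` ({..<n} \<times> {..<n})"]) auto

lemma dist_le_3: "x < n \<Longrightarrow> y < n \<Longrightarrow> d x y \<le> 3"
  using Max_ge[OF finite_dists] diam unfolding diameter_def by fastforce

text \<open>Walking back along a geodesic from a diametral pair meets every smaller distance, so
  each intersection number is realized by an actual pair of vertices.\<close>

lemma ex_dist:
  assumes "i \<le> 3"
  shows "\<exists>x<n. \<exists>y<n. d x y = i"
proof -
  \<comment> \<open>The induction descends from distance 3; for \<open>j > 3\<close> the truncated
    difference stays at 0.\<close>
  have "\<exists>x<n. \<exists>y<n. d x y = 3 - j" for j
  proof (induction j)
    case 0
    have "{d x y | x y. x < n \<and> y < n} \<noteq> {}" using n_pos by blast
    from Max_in[OF finite_dists this] diam show ?case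
      unfolding diameter_def by auto
  next
    case (Suc j)
    then obtain x y where xy: "x < n" "y < n" "d x y = 3 - j" by blast
    show ?case
    proof (cases "j < 3")
      case True
      hence "d x y = Suc (3 - Suc j)" using xy by simp
      then obtain z where "z < n" "d x z = 3 - Suc j" using dist_pred[OF xy(1,2)] by metis
      thus ?thesis using xy by blast
    qed (use Suc in simp)
  qed
  from this[of "3 - i"] assms show ?thesis by simp
qed

section \<open>Intersection numbers\<close>

lemma c_0: "c 0 = 0"
  using ex_dist[of 0] card_c by fastforce

lemma c_pos: "1 \<le> i \<Longrightarrow> i \<le> 3 \<Longrightarrow> c i > 0"
proof -
  assume i: "1 \<le> i" "i \<le> 3"
  then obtain x y where xy: "x < n" "y < n" "d x y = i" using ex_dist by blast
  then obtain z where z: "z < n" "E z y" "d x z = i - 1"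
    using dist_pred[of x y "i - 1"] i by (metis Suc_diff_le diff_Suc_Suc diff_zero One_nat_def)
  hence "z \<in> {z. z < n \<and> E y z \<and> d x z + 1 = i}" using sym xy i by auto
  hence "card {z. z < n \<and> E y z \<and> d x z + 1 = i} > 0" by (auto simp: card_gt_0_iff)
  thus ?thesis using card_c[OF xy] i by simp
qed

lemma b_pos: "i \<le> 2 \<Longrightarrow> b i > 0"
proof -
  assume i: "i \<le> 2"
  then obtain x y where xy: "x < n" "y < n" "d x y = i + 1" using ex_dist[of "i + 1"] by auto
  then obtain z where z: "z < n" "E z y" "d x z = i"
    using dist_pred[of x y i] by auto
  hence "y \<in> {y. y < n \<and> E z y \<and> d x y = i + 1}" using xy by auto
  hence "card {y. y < n \<and> E z y \<and> d x y = i + 1} > 0" by (auto simp: card_gt_0_iff)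
  thus ?thesis using card_b[OF xy(1) z(1,3)] i by simp
qed

lemma c_1: "c 1 = 1"
proof -
  obtain x y where xy: "x < n" "y < n" "d x y = 1" using ex_dist[of 1] by auto
  have "{z. z < n \<and> E y z \<and> d x z + 1 = 1} = {x}"
  proof (intro equalityI subsetI)
    fix z assume "z \<in> {z. z < n \<and> E y z \<and> d x z + 1 = 1}"
    thus "z \<in> {x}" using dist_eq_0_iff[OF xy(1), of z] by simp
  next
    fix z assume "z \<in> {x}"
    thus "z \<in> {z. z < n \<and> E y z \<and> d x z + 1 = 1}"
      using xy sym[of x y] dist_eq_1_iff[OF xy(1,2)] by (simp add: dist_refl)
  qed
  thus ?thesis using card_c[OF xy] by simp
qed

lemma b_3: "b 3 = 0"
proof -
  obtain x y where xy: "x < n" "y < n" "d x y = 3" using ex_dist[of 3] by auto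
  have "{z. z < n \<and> E y z \<and> d x z = 3 + 1} = {}"
    using xy dist_le_3 by fastforce
  thus ?thesis using card_b[OF xy] by (metis card.empty order_refl)
qed

lemma valency: "x < n \<Longrightarrow> card {z. z < n \<and> E x z} = b 0"
proof -
  assume x: "x < n"
  have "{z. z < n \<and> E x z \<and> d x z = 0 + 1} = {z. z < n \<and> E x z}"
    using x dist_eq_1_iff by auto
  thus ?thesis using card_b[OF x x, of 0] by (simp add: dist_refl)
qed

lemma card_a:
  assumes xy: "x < n" "y < n" "d x y = i"
  shows "int (card {z. z < n \<and> E y z \<and> d x z = i}) = intersection_a b c i"
proof -
  let ?N = "\<lambda>P. {z. z < n \<and> E y z \<and> P (d x z)}"
  have i3: "i \<le> 3" using dist_le_3 xy by blast
  have "{z. z < n \<and> E y z} = ?N (\<lambda>k. k = i) \<union> (?N (\<lambda>k. k + 1 = i) \<union> ?N (\<lambda>k. k = i + 1))"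
    using dist_step[OF xy(1,2)] dist_step'[OF xy(1,2)] xy(3) by force
  hence "card {z. z < n \<and> E y z} = card (?N (\<lambda>k. k = i) \<union> (?N (\<lambda>k. k + 1 = i) \<union> ?N (\<lambda>k. k = i + 1)))"
    by simp
  also have "\<dots> = card (?N (\<lambda>k. k = i)) + (card (?N (\<lambda>k. k + 1 = i)) + card (?N (\<lambda>k. k = i + 1)))"
    by (subst card_Un_disjoint; (subst card_Un_disjoint)?) auto
  finally show ?thesis
    using card_c[OF xy i3] card_b[OF xy i3] valency[OF xy(2)] by (simp add: intersection_a_def)
qed

lemma intersection_a_nonneg: "i \<le> 3 \<Longrightarrow> intersection_a b c i \<ge> 0"
  using ex_dist[of i] card_a by (metis of_nat_0_le_iff)

section \<open>The distance matrices as operators on vertex functions\<close>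

definition dist_op :: "nat \<Rightarrow> (nat \<Rightarrow> real) \<Rightarrow> nat \<Rightarrow> real" where
  "dist_op i f x = (\<Sum>z<n. of_bool (d x z = i) * f z)"

lemma dist_op_0: "x < n \<Longrightarrow> dist_op 0 f x = f x"
proof -
  assume x: "x < n"
  have "dist_op 0 f x = (\<Sum>z<n. if z = x then f z else 0)"
    unfolding dist_op_def by (intro sum.cong refl) (auto simp: dist_eq_0_iff[OF x])
  thus ?thesis using x by simp
qed

lemma dist_op_cong: "(\<And>z. z < n \<Longrightarrow> f z = g z) \<Longrightarrow> dist_op i f x = dist_op i g x"
  unfolding dist_op_def by (intro sum.cong refl) simp

lemma dist_op_scale: "dist_op i (\<lambda>z. r * f z) x = r * dist_op i f x"
  unfolding dist_op_def sum_distrib_left by (intro sum.cong refl) simp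

lemma sum_dist_op: "x < n \<Longrightarrow> (\<Sum>i\<le>3. dist_op i f x) = (\<Sum>z<n. f z)"
proof -
  assume x: "x < n"
  have "(\<Sum>i\<le>3. dist_op i f x) = (\<Sum>z<n. \<Sum>i\<le>3. of_bool (d x z = i) * f z)"
    unfolding dist_op_def by (rule sum.swap)
  also have "\<dots> = (\<Sum>z<n. f z)"
  proof (intro sum.cong refl)
    fix z assume "z \<in> {..<n}"
    hence z: "d x z \<in> {..3}" using dist_le_3[OF x] by simp
    have "(\<Sum>i\<le>3. of_bool (d x z = i) * f z) = (\<Sum>i\<le>3. if d x z = i then f z else 0)"
      by (intro sum.cong refl) simp
    also have "\<dots> = f z" using z by (subst sum.delta') auto
    finally show "(\<Sum>i\<le>3. of_bool (d x z = i) * f z) = f z" .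
  qed
  finally show ?thesis .
qed

text \<open>This is the three-term recurrence of the distance matrices, entry by entry: the
  neighbours of \<open>x\<close> at distance \<open>j\<close> from \<open>y\<close> are counted by
  \<open>b\<close>, \<open>a\<close> or \<open>c\<close> according as \<open>d x y\<close> is
  \<open>j - 1\<close>, \<open>j\<close> or \<open>j + 1\<close>. The conditionals guard the ends,
  where \<open>j - 1\<close> truncates to 0 and \<open>c 4\<close> is unspecified.\<close>

lemma adjacency_dist_entry:
  assumes xy: "x < n" "y < n" and j: "j \<le> 3"
  shows "(\<Sum>z<n. of_bool (d x z = 1) * of_bool (d z y = j)) =
     (if j = 0 then 0 else real (b (j - 1))) * of_bool (d x y = j - 1)
     + of_int (intersection_a b c j) * of_bool (d x y = j)
     + (if j = 3 then 0 else real (c (j + 1))) * of_bool (d x y = j + 1)"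
proof -
  let ?S = "{z. z < n \<and> E x z \<and> d y z = j}"
  have "(\<Sum>z<n. of_bool (d x z = 1) * of_bool (d z y = j)) = (\<Sum>z<n. of_bool (z \<in> ?S) :: real)"
  proof (intro sum.cong refl)
    fix z assume "z \<in> {..<n}"
    hence "z < n" "d x z = 1 \<longleftrightarrow> E x z" "d z y = d y z"
      using dist_eq_1_iff[OF xy(1)] dist_sym[OF _ xy(2)] by auto
    thus "of_bool (d x z = 1) * of_bool (d z y = j) = (of_bool (z \<in> ?S) :: real)"
      by (simp del: One_nat_def)
  qed
  also have "\<dots> = real (card ?S)"
    by (subst sum_of_bool_eq) (auto intro!: arg_cong[where f = card])
  finally have lhs: "(\<Sum>z<n. of_bool (d x z = 1) * of_bool (d z y = j)) = real (card ?S)" .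
  define i where "i = d y x"
  have i: "d x y = i" "i \<le> 3" using dist_le_3[of y x] dist_sym xy by (auto simp: i_def)
  consider "j + 1 = i" | "j = i" | "j = i + 1" | "j + 1 < i \<or> i + 1 < j" by linarith
  thus ?thesis
  proof cases
    case 1
    have S: "card ?S = c (j + 1)"
      using card_c[OF xy(2,1) i_def[symmetric] i(2)] unfolding 1[symmetric] by simp
    have "i \<noteq> j" "i = j + 1" "j \<noteq> 3" "j = 0 \<or> i \<noteq> j - 1" using 1 i(2) by linarith+
    thus ?thesis unfolding lhs i(1) S by auto
  next
    case 2
    hence S: "real (card ?S) = of_int (intersection_a b c j)"
      using arg_cong[OF card_a[OF xy(2,1) i_def[symmetric]], of real_of_int] by simp
    have "i = j" "j = 0 \<or> i \<noteq> j - 1" "i \<noteq> j + 1" using 2 by linarith+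
    thus ?thesis unfolding lhs i(1) S by auto
  next
    case 3
    hence S: "card ?S = b (j - 1)"
      using card_b[OF xy(2,1) i_def[symmetric] i(2)] by simp
    have "i = j - 1" "j \<noteq> 0" "i \<noteq> j" "i \<noteq> j + 1" using 3 by linarith+
    thus ?thesis unfolding lhs i(1) S by auto
  next
    case 4
    have "?S = {}"
    proof (intro equals0I)
      fix z assume "z \<in> ?S"
      hence "d y z \<le> i + 1" "i \<le> d y z + 1" "d y z = j"
        using dist_step[OF xy(2,1)] dist_step'[OF xy(2,1)] by (auto simp: i_def)
      thus False using 4 by linarith
    qed
    hence "card ?S = 0" by (simp only: card.empty)
    moreover have "i \<noteq> j" "i \<noteq> j + 1" "j = 0 \<or> i \<noteq> j - 1" using 4 by linarith+
    ultimately show ?thesis unfolding lhs i(1) by auto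
  qed
qed

lemma dist_op_recurrence:
  assumes x: "x < n" and j: "j \<le> 3"
  shows "dist_op 1 (dist_op j f) x =
     (if j = 0 then 0 else real (b (j - 1))) * dist_op (j - 1) f x
     + of_int (intersection_a b c j) * dist_op j f x
     + (if j = 3 then 0 else real (c (j + 1))) * dist_op (j + 1) f x"
proof -
  have "dist_op 1 (dist_op j f) x =
      (\<Sum>z<n. \<Sum>y<n. of_bool (d x z = 1) * of_bool (d z y = j) * f y)"
    unfolding dist_op_def sum_distrib_left by (simp only: mult.assoc)
  also have "\<dots> = (\<Sum>y<n. (\<Sum>z<n. of_bool (d x z = 1) * of_bool (d z y = j)) * f y)"
    by (subst sum.swap) (simp only: sum_distrib_right)
  also have "\<dots> = (\<Sum>y<n. ((if j = 0 then 0 else real (b (j - 1))) * of_bool (d x y = j - 1)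
     + of_int (intersection_a b c j) * of_bool (d x y = j)
     + (if j = 3 then 0 else real (c (j + 1))) * of_bool (d x y = j + 1)) * f y)"
    using x j by (intro sum.cong refl arg_cong2[where f = "(*)"] adjacency_dist_entry) simp_all
  also have "\<dots> = (if j = 0 then 0 else real (b (j - 1))) * dist_op (j - 1) f x
     + of_int (intersection_a b c j) * dist_op j f x
     + (if j = 3 then 0 else real (c (j + 1))) * dist_op (j + 1) f x"
    unfolding dist_op_def sum_distrib_left
    by (simp only: distrib_right sum.distrib mult.assoc)
  finally show ?thesis .
qed

section \<open>The Hoffman polynomial and eigenfunctions\<close>

abbreviation k :: real where "k \<equiv> real (b 0)"
abbreviation a :: "nat \<Rightarrow> real" where "a i \<equiv> of_int (intersection_a b c i)"

text \<open>A multiple of the Hoffman polynomial: at the adjacency matrix it takes the value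
  \<open>c 2 * c 3\<close> times the all-ones matrix.\<close>
definition hoffman :: "real \<Rightarrow> real" where
  "hoffman t = (t\<^sup>2 - a 1 * t - k) * (t - a 2 + real (c 3))
     + real (c 2) * (real (c 3) * (1 + t) - real (b 1) * t)"

lemma a_eq:
  "a 0 = 0" "a 1 = k - real (b 1) - 1" "a 2 = k - real (b 2) - real (c 2)" "a 3 = k - real (c 3)"
  using c_0 c_1 b_3 by (simp_all add: intersection_a_def)

lemma dist_op_2_recurrence:
  "x < n \<Longrightarrow> dist_op 1 (dist_op 1 f) x = k * f x + a 1 * dist_op 1 f x + real (c 2) * dist_op 2 f x"
  using dist_op_recurrence[of x 1 f] by (simp add: dist_op_0 numeral_2_eq_2)

lemma dist_op_3_recurrence:
  "x < n \<Longrightarrow> dist_op 1 (dist_op 2 f) x =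
     real (b 1) * dist_op 1 f x + a 2 * dist_op 2 f x + real (c 3) * dist_op 3 f x"
  using dist_op_recurrence[of x 2 f] by (simp add: numeral_3_eq_3)

lemma sum_dist_op_expand:
  "x < n \<Longrightarrow> f x + dist_op 1 f x + dist_op 2 f x + dist_op 3 f x = (\<Sum>z<n. f z)"
  using sum_dist_op[of x f] by (simp add: dist_op_0 numeral_3_eq_3 numeral_2_eq_2)

text \<open>On an eigenfunction the recurrence turns each distance operator into multiplication by a
  polynomial in \<open>t\<close>. The factors \<open>c 2\<close> and \<open>c 3\<close> clear its
  denominators, and adding the four operators gives \<open>hoffman\<close>.\<close>

lemma eigenfunction:
  assumes f: "\<And>x. x < n \<Longrightarrow> dist_op 1 f x = t * f x" and x: "x < n"
  shows "real (c 2) * real (c 3) * dist_op 3 f x =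
      ((t - a 2) * (t\<^sup>2 - a 1 * t - k) - real (b 1) * real (c 2) * t) * f x"
    and "real (c 2) * real (c 3) * (\<Sum>z<n. f z) = hoffman t * f x"
proof -
  let ?q = "t\<^sup>2 - a 1 * t - k"
  have d2: "real (c 2) * dist_op 2 f z = ?q * f z" if z: "z < n" for z
  proof -
    have "dist_op 1 (dist_op 1 f) z = dist_op 1 (\<lambda>z. t * f z) z"
      using f by (intro dist_op_cong)
    hence "dist_op 1 (dist_op 1 f) z = t * (t * f z)" using f[OF z] by (simp only: dist_op_scale)
    thus ?thesis using dist_op_2_recurrence[OF z, of f] f[OF z]
      by (simp add: algebra_simps power2_eq_square)
  qed
  have "real (c 2) * dist_op 1 (dist_op 2 f) x = dist_op 1 (\<lambda>z. real (c 2) * dist_op 2 f z) x"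
    by (simp only: dist_op_scale)
  also have "\<dots> = dist_op 1 (\<lambda>z. ?q * f z) x"
    using d2 by (intro dist_op_cong)
  also have "\<dots> = ?q * (t * f x)" using f[OF x] by (simp only: dist_op_scale)
  finally have e: "real (c 2) * (real (b 1) * (t * f x) + a 2 * dist_op 2 f x + real (c 3) * dist_op 3 f x)
      = ?q * (t * f x)"
    unfolding dist_op_3_recurrence[OF x] f[OF x] .
  have "real (c 2) * real (c 3) * dist_op 3 f x =
      ?q * (t * f x) - real (c 2) * (real (b 1) * (t * f x)) - a 2 * (real (c 2) * dist_op 2 f x)"
    using e by (simp add: algebra_simps)
  also have "\<dots> = ((t - a 2) * ?q - real (b 1) * real (c 2) * t) * f x"
    unfolding d2[OF x] by (simp add: algebra_simps)
  finally show d3: "real (c 2) * real (c 3) * dist_op 3 f x =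
      ((t - a 2) * ?q - real (b 1) * real (c 2) * t) * f x" .
  have "real (c 2) * real (c 3) * (\<Sum>z<n. f z) =
      real (c 2) * real (c 3) * (f x + t * f x) + real (c 3) * (real (c 2) * dist_op 2 f x)
      + real (c 2) * real (c 3) * dist_op 3 f x"
    unfolding sum_dist_op_expand[OF x, symmetric] f[OF x] by (simp add: algebra_simps)
  thus "real (c 2) * real (c 3) * (\<Sum>z<n. f z) = hoffman t * f x"
    unfolding d2[OF x] d3 hoffman_def by (simp add: algebra_simps)
qed

lemma dist_op_1_const: "x < n \<Longrightarrow> dist_op 1 (\<lambda>_. 1) x = k"
proof -
  assume x: "x < n"
  have "{..<n} \<inter> {z. d x z = 1} = {z. z < n \<and> E x z}"
    using dist_eq_1_iff[OF x] by auto
  thus ?thesis using valency[OF x] by (simp add: dist_op_def)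
qed

text \<open>The adjacency matrix is symmetric with constant row sums, so the constant function is
  also a left eigenvector.\<close>

lemma sum_dist_op_1: "(\<Sum>x<n. dist_op 1 f x) = k * (\<Sum>x<n. f x)"
proof -
  have "(\<Sum>x<n. dist_op 1 f x) = (\<Sum>z<n. \<Sum>x<n. of_bool (d x z = 1) * f z)"
    unfolding dist_op_def by (rule sum.swap)
  also have "\<dots> = (\<Sum>z<n. f z * dist_op 1 (\<lambda>_. 1) z)"
    unfolding dist_op_def sum_distrib_left
    by (intro sum.cong refl) (metis dist_sym lessThan_iff mult.commute mult.right_neutral)
  also have "\<dots> = (\<Sum>z<n. k * f z)"
    by (intro sum.cong refl) (simp only: dist_op_1_const lessThan_iff mult.commute)
  finally show ?thesis by (simp only: sum_distrib_left)
qed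

lemma hoffman_valency: "hoffman k = real (c 2) * real (c 3) * real n"
  using eigenfunction(2)[of "\<lambda>_. 1" k 0] n_pos dist_op_1_const by simp

text \<open>Applying \<open>eigenfunction\<close> to the constant function at \<open>t = k\<close>
  gives the size of the sphere of radius 3.\<close>

lemma dist_op_3_const:
  assumes "x < n"
  shows "real (c 2) * real (c 3) * dist_op 3 (\<lambda>_. 1) x = real (b 1) * real (b 2) * k"
  using eigenfunction(1)[of "\<lambda>_. 1" k x] assms dist_op_1_const
  unfolding a_eq by (simp add: algebra_simps power2_eq_square)

section \<open>Eigenvalues of the adjacency matrix and traces of its powers\<close>

lemma adj_carrier: "adj_matrix E n \<in> carrier_mat n n"
  by (simp add: adj_matrix_def)

lemma adj_entry: "x < n \<Longrightarrow> y < n \<Longrightarrow> adj_matrix E n $$ (x, y) = of_bool (d x y = 1)"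
  using dist_eq_1_iff[of x y] by (simp add: adj_matrix_def)

text \<open>For \<open>t \<noteq> k\<close> the entries of an eigenvector sum to zero, by
  \<open>sum_dist_op_1\<close>; then \<open>hoffman t\<close> annihilates a nonzero entry.\<close>

lemma eigenvalue_hoffman:
  assumes "eigenvalue (adj_matrix E n) t"
  shows "(t - k) * hoffman t = 0"
proof -
  obtain v where v: "v \<in> carrier_vec n" "v \<noteq> 0\<^sub>v n" "adj_matrix E n *\<^sub>v v = t \<cdot>\<^sub>v v"
    using assms adj_carrier unfolding eigenvalue_def eigenvector_def by auto
  have f: "dist_op 1 (\<lambda>i. v $ i) x = t * v $ x" if x: "x < n" for x
  proof -
    have "t * v $ x = (adj_matrix E n *\<^sub>v v) $ x" using v x by simp
    also have "\<dots> = (\<Sum>z<n. adj_matrix E n $$ (x, z) * v $ z)"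
      using v(1) x adj_carrier by (simp add: scalar_prod_def lessThan_atLeast0)
    also have "\<dots> = dist_op 1 (\<lambda>i. v $ i) x"
      unfolding dist_op_def using adj_entry[OF x] by (intro sum.cong refl) simp
    finally show ?thesis by simp
  qed
  have "k * (\<Sum>x<n. v $ x) = (\<Sum>x<n. t * v $ x)"
    unfolding sum_dist_op_1[symmetric] using f by (intro sum.cong refl) simp
  hence "(t - k) * (\<Sum>x<n. v $ x) = 0" unfolding sum_distrib_left[symmetric] by auto
  moreover obtain i where i: "i < n" "v $ i \<noteq> 0"
    using v(1,2) by (metis eq_vecI carrier_vecD index_zero_vec)
  moreover have "real (c 2) * real (c 3) * (\<Sum>x<n. v $ x) = hoffman t * v $ i"
    using f i by (intro eigenfunction(2))
  ultimately show ?thesis by auto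
qed

lemma walk_2: "x < n \<Longrightarrow> y < n \<Longrightarrow> (\<Sum>z<n. of_bool (d x z = 1) * of_bool (d z y = 1)) =
    k * of_bool (d x y = 0) + a 1 * of_bool (d x y = 1) + real (c 2) * of_bool (d x y = 2)"
  using adjacency_dist_entry[of x y 1] by (simp add: numeral_2_eq_2)

lemma trace_adj:
  "mtrace (adj_matrix E n ^\<^sub>m 0) = real n"
  "mtrace (adj_matrix E n ^\<^sub>m 1) = 0"
  "mtrace (adj_matrix E n ^\<^sub>m 2) = real n * k"
  "mtrace (adj_matrix E n ^\<^sub>m 3) = real n * k * a 1"
proof -
  let ?A = "adj_matrix E n"
  note A = adj_carrier
  have tr: "mtrace M = (\<Sum>x<n. M $$ (x, x))" if "M \<in> carrier_mat n n" for M :: "real mat"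
    using that by (simp add: mtrace_def)
  have prod: "(M * ?A) $$ (x, y) = (\<Sum>z<n. M $$ (x, z) * of_bool (d z y = 1))"
    if "M \<in> carrier_mat n n" "x < n" "y < n" for M x y
    using that A adj_entry[of _ y] by (simp add: scalar_prod_def lessThan_atLeast0)
  have A1: "?A ^\<^sub>m 1 = ?A" using A by simp
  have A2: "?A ^\<^sub>m 2 = ?A * ?A" using A by (simp add: numeral_2_eq_2)
  have A3: "?A ^\<^sub>m 3 = (?A * ?A) * ?A" using A by (simp add: numeral_3_eq_3)
  have A2e: "(?A * ?A) $$ (x, y) =
      k * of_bool (d x y = 0) + a 1 * of_bool (d x y = 1) + real (c 2) * of_bool (d x y = 2)"
    if "x < n" "y < n" for x y
    unfolding prod[OF A that] walk_2[OF that, symmetric]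
    using adj_entry[OF that(1)] by (intro sum.cong refl) simp
  show "mtrace (?A ^\<^sub>m 0) = real n" using A by (simp add: mtrace_def)
  show "mtrace (?A ^\<^sub>m 1) = 0" unfolding A1 tr[OF A] by (intro sum.neutral) (simp add: adj_entry dist_refl)
  have "mtrace (?A * ?A) = (\<Sum>x<n. k)"
    unfolding tr[OF mult_carrier_mat[OF A A]] by (intro sum.cong refl) (simp add: A2e dist_refl del: index_mult_mat)
  thus "mtrace (?A ^\<^sub>m 2) = real n * k" unfolding A2 by simp
  have "(?A * ?A * ?A) $$ (x, x) = k * a 1" if x: "x < n" for x
  proof -
    have "(?A * ?A * ?A) $$ (x, x) = (\<Sum>z<n. (?A * ?A) $$ (x, z) * of_bool (d z x = 1))"
      using A x by (intro prod) auto
    \<comment> \<open>Only neighbours \<open>z\<close> of \<open>x\<close> contribute, and each has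
      \<open>a 1\<close> walks of length 2 from \<open>x\<close>.\<close>
    also have "\<dots> = (\<Sum>z<n. a 1 * (of_bool (d x z = 1) * of_bool (d z x = 1)))"
      using x A2e dist_sym[of x] by (intro sum.cong refl) auto
    also have "\<dots> = a 1 * k"
      unfolding sum_distrib_left[symmetric] walk_2[OF x x] by (simp add: dist_refl)
    finally show ?thesis by simp
  qed
  thus "mtrace (?A ^\<^sub>m 3) = real n * k * a 1"
    unfolding A3 using A by (simp add: tr mult.assoc)
qed

lemma trace_spectrum:
  assumes eigs: "{x. eigenvalue (adj_matrix E n) x} = \<theta> ` {0..3::nat}" and inj: "inj_on \<theta> {0..3}"
  shows "mtrace (adj_matrix E n ^\<^sub>m p) = (\<Sum>i\<le>3. real (eig_mult (adj_matrix E n) (\<theta> i)) * \<theta> i ^ p)"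
proof -
  have "adj_matrix E n $$ (i, j) = adj_matrix E n $$ (j, i)" if "i < n" "j < n" for i j
    using that dist_sym by (simp add: adj_entry)
  from mtrace_pow_symmetric[OF adj_carrier this, of p] show ?thesis
    unfolding eigs sum.reindex[OF inj] by (simp add: atLeast0AtMost)
qed

text \<open>In other words, the intersection number \<open>p\<close> with all three indices equal to 3 is non-negative.\<close>
lemma intersection_number_333:
  "real (c 2) * real (c 3) * (1 + a 3) + real (c 3) * (real (b 2) * real (c 3) + (a 3)\<^sup>2 - k - a 1 * a 3)
     \<le> real (b 1) * real (b 2) * k"
proof -
  obtain x y where xy: "x < n" "y < n" "d x y = 3" using ex_dist[of 3] by auto
  \<comment> \<open>\<open>f\<close> is the indicator of the sphere of radius 3 around
    \<open>y\<close>. Evaluating the square of the adjacency operator on \<open>f\<close> at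
    \<open>x\<close> in two ways gives the number of vertices at distance 2 from \<open>x\<close>
    and 3 from \<open>y\<close>.\<close>
  define f where "f z = (of_bool (d z y = 3) :: real)" for z
  have f1: "dist_op 1 f z = real (b 2) * of_bool (d z y = 2) + a 3 * f z" if "z < n" for z
    using adjacency_dist_entry[OF that xy(2), of 3] by (simp add: dist_op_def f_def)
  have "dist_op 1 (dist_op 1 f) x = dist_op 1 (\<lambda>z. real (b 2) * of_bool (d z y = 2) + a 3 * f z) x"
    using f1 by (intro dist_op_cong)
  also have "\<dots> = real (b 2) * dist_op 1 (\<lambda>z. of_bool (d z y = 2)) x + a 3 * dist_op 1 f x"
    unfolding dist_op_def sum_distrib_left sum.distrib[symmetric]
    by (intro sum.cong refl) (simp only: distrib_left mult.left_commute)
  also have "dist_op 1 (\<lambda>z. of_bool (d z y = 2)) x = real (c 3)"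
    using adjacency_dist_entry[OF xy(1,2), of 2] xy(3) by (simp add: dist_op_def)
  also have fx: "dist_op 1 f x = a 3" using f1[OF xy(1)] xy(3) by (simp add: f_def)
  finally have "real (b 2) * real (c 3) + a 3 * a 3 = k * f x + a 1 * a 3 + real (c 2) * dist_op 2 f x"
    using dist_op_2_recurrence[OF xy(1), of f] unfolding fx by simp
  moreover have f_x: "f x = 1" using xy(3) by (simp add: f_def)
  ultimately have d2: "real (c 2) * dist_op 2 f x = real (b 2) * real (c 3) + (a 3)\<^sup>2 - k - a 1 * a 3"
    by (simp add: power2_eq_square)
  have "(\<Sum>z<n. f z) = dist_op 3 (\<lambda>_. 1) y"
    unfolding f_def dist_op_def using dist_sym[OF xy(2)] by (intro sum.cong refl) simp
  \<comment> \<open>This value counts the vertices at distance 3 from both \<open>x\<close> and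
    \<open>y\<close>; the remaining three distances from \<open>x\<close> therefore account for at
    most the whole sphere around \<open>y\<close>.\<close>
  moreover have "dist_op 3 f x \<ge> 0" unfolding dist_op_def f_def by (intro sum_nonneg) simp
  ultimately have "1 + a 3 + dist_op 2 f x \<le> dist_op 3 (\<lambda>_. 1) y"
    using sum_dist_op_expand[OF xy(1), of f] unfolding fx f_x by linarith
  hence "real (c 2) * real (c 3) * (1 + a 3 + dist_op 2 f x)
      \<le> real (c 2) * real (c 3) * dist_op 3 (\<lambda>_. 1) y"
    by (intro mult_left_mono) auto
  hence "real (c 2) * real (c 3) * (1 + a 3) + real (c 3) * (real (c 2) * dist_op 2 f x)
      \<le> real (b 1) * real (b 2) * k"
    unfolding dist_op_3_const[OF xy(2)] by (simp add: algebra_simps)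
  thus ?thesis unfolding d2 .
qed

text \<open>The eigenvalues below \<open>k\<close> are roots of \<open>hoffman\<close>. Summing
  \<open>hoffman\<close> over the spectrum with multiplicities therefore leaves only the term of
  \<open>\<theta> 0\<close>, while the traces give the nonzero total \<open>n * c 2 * c 3\<close>,
  which is also \<open>hoffman k\<close>. So \<open>\<theta> 0\<close> is \<open>k\<close>, with
  multiplicity 1.\<close>

lemma spectrum_of_small_theta_1:
  assumes eigs: "{x. eigenvalue (adj_matrix E n) x} = \<theta> ` {0..3::nat}"
    and decr: "\<And>i j. i < j \<Longrightarrow> j \<le> 3 \<Longrightarrow> \<theta> j < \<theta> i"
    and small: "\<theta> 1 < k"
  shows "\<theta> 0 = k" "eig_mult (adj_matrix E n) (\<theta> 0) = 1"
    "hoffman (\<theta> 1) = 0" "hoffman (\<theta> 2) = 0" "hoffman (\<theta> 3) = 0"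
proof -
  let ?m = "\<lambda>i. real (eig_mult (adj_matrix E n) (\<theta> i))"
  have inj: "inj_on \<theta> {0..3}" by (rule inj_onI) (metis atLeastAtMost_iff decr less_irrefl nat_neq_iff)
  have root: "(\<theta> i - k) * hoffman (\<theta> i) = 0" if "i \<le> 3" for i
    using eigs that by (intro eigenvalue_hoffman) auto
  have lt: "\<theta> 2 < \<theta> 1" "\<theta> 3 < \<theta> 1" using decr[of 1 2] decr[of 1 3] by auto
  show h: "hoffman (\<theta> 1) = 0" "hoffman (\<theta> 2) = 0" "hoffman (\<theta> 3) = 0"
    using root[of 1] root[of 2] root[of 3] small lt by auto
  have tr: "?m 0 * \<theta> 0 ^ p + ?m 1 * \<theta> 1 ^ p + ?m 2 * \<theta> 2 ^ p + ?m 3 * \<theta> 3 ^ p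
      = mtrace (adj_matrix E n ^\<^sub>m p)" for p
    unfolding trace_spectrum[OF eigs inj] by (simp add: numeral_3_eq_3 numeral_2_eq_2)
  \<comment> \<open>The powers \<open>t ^ 1\<close> and \<open>t ^ 0\<close> are kept so that every
    monomial matches a trace in \<open>tr\<close>.\<close>
  have expand: "hoffman t = t ^ 3 + (real (c 3) - a 2 - a 1) * t ^ 2
      + (a 1 * (a 2 - real (c 3)) - k + real (c 2) * (real (c 3) - real (b 1))) * t ^ 1
      + (k * (a 2 - real (c 3)) + real (c 2) * real (c 3)) * t ^ 0" for t
    unfolding hoffman_def by (simp add: algebra_simps eval_nat_numeral)
  have "?m 0 * hoffman (\<theta> 0) = ?m 0 * hoffman (\<theta> 0) + ?m 1 * hoffman (\<theta> 1) + ?m 2 * hoffman (\<theta> 2) + ?m 3 * hoffman (\<theta> 3)"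
    by (simp only: h mult_zero_right add_0_right)
  also have "\<dots> = mtrace (adj_matrix E n ^\<^sub>m 3)
      + (real (c 3) - a 2 - a 1) * mtrace (adj_matrix E n ^\<^sub>m 2)
      + (a 1 * (a 2 - real (c 3)) - k + real (c 2) * (real (c 3) - real (b 1))) * mtrace (adj_matrix E n ^\<^sub>m 1)
      + (k * (a 2 - real (c 3)) + real (c 2) * real (c 3)) * mtrace (adj_matrix E n ^\<^sub>m 0)"
    unfolding expand tr[symmetric] distrib_left by (simp only: mult_ac add_ac)
  also have "\<dots> = real n * (real (c 2) * real (c 3))"
    unfolding trace_adj by (simp add: algebra_simps)
  finally have m0: "?m 0 * hoffman (\<theta> 0) = real n * (real (c 2) * real (c 3))" .
  moreover have nz: "real n * (real (c 2) * real (c 3)) \<noteq> 0"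
    using n_pos c_pos[of 2] c_pos[of 3] by simp
  ultimately have "hoffman (\<theta> 0) \<noteq> 0" by auto
  thus th: "\<theta> 0 = k" using root[of 0] by simp
  have "?m 0 = 1" using m0 nz unfolding th hoffman_valency by simp
  thus "eig_mult (adj_matrix E n) (\<theta> 0) = 1" by simp
qed

section \<open>Parameters of a Shilla graph\<close>

lemma shilla_parameters:
  assumes "hoffman (a 3) = 0"
  shows "k = a 3 * (a 3 - a 1)" "real (c 3) = a 3 * (a 3 - a 1 - 1)"
    "real (b 1) = (a 3 + 1) * (a 3 - a 1 - 1)"
proof -
  have c3: "real (c 3) = k - a 3" and b1: "real (b 1) = k - 1 - a 1"
    and a2: "a 2 = k - real (b 2) - real (c 2)" using a_eq by auto
  \<comment> \<open>The defining condition on \<open>a 3\<close> enters here: \<open>b 2\<close> is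
    nonzero, so the other factor vanishes and determines the valency.\<close>
  have "hoffman (a 3) = real (b 2) * ((a 3)\<^sup>2 - a 1 * a 3 - k)"
    unfolding hoffman_def c3 b1 a2 by (simp add: algebra_simps power2_eq_square)
  moreover have "real (b 2) \<noteq> 0" using b_pos[of 2] by simp
  ultimately have "(a 3)\<^sup>2 - a 1 * a 3 - k = 0" using assms by simp
  thus k: "k = a 3 * (a 3 - a 1)" by (simp add: algebra_simps power2_eq_square)
  show "real (c 3) = a 3 * (a 3 - a 1 - 1)" "real (b 1) = (a 3 + 1) * (a 3 - a 1 - 1)"
    unfolding c3 b1 k by (simp_all add: algebra_simps)
qed

text \<open>Splitting off the known root leaves a quadratic for the two smallest eigenvalues, whose
  coefficients yield their sum and product.\<close>

lemma hoffman_shilla_factor: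
  assumes "hoffman (a 3) = 0"
  defines "B \<equiv> a 3 - a 1"
  shows "hoffman t = (t - a 3) * (t\<^sup>2 + (B + real (b 2) + real (c 2) - a 3) * t
      + (B * real (b 2) + real (c 2) - a 3 * B))"
proof -
  have a1: "a 1 = a 3 - B" by (simp add: B_def)
  have a2: "a 2 = k - real (b 2) - real (c 2)" by (rule a_eq)
  show ?thesis
    unfolding hoffman_def a2 shilla_parameters[OF assms(1), folded B_def] a1
    by (simp add: algebra_simps power2_eq_square)
qed

end

section \<open>Shilla graphs\<close>

theorem theorem11:
  fixes E :: "nat \<Rightarrow> nat \<Rightarrow> bool" and n :: nat
    and b c :: "nat \<Rightarrow> nat" and \<theta> :: "nat \<Rightarrow> real"
  assumes drg: "distance_regular E n 3 b c"
    and eigs: "{x. eigenvalue (adj_matrix E n) x} = \<theta> ` {0..3}"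
    and decr: "\<And>i j. i < j \<Longrightarrow> j \<le> 3 \<Longrightarrow> \<theta> j < \<theta> i"
    and shilla: "\<theta> 1 = of_int (intersection_a b c 3)"
    and bge2: "intersection_a b c 3 - intersection_a b c 1 \<ge> 2"
    and mult: "eig_mult (adj_matrix E n) (\<theta> 2) = eig_mult (adj_matrix E n) (\<theta> 3)"
  shows "let a1 = intersection_a b c 1; a3 = intersection_a b c 3; bb = a3 - a1 in
           (a3 - bb < int (b 2) + int (c 2) \<and> int (b 2) + int (c 2) < a3 + bb)
         \<and> int (c 2) < int (b 2) + bb
         \<and> ((int (b 2) + int (c 2) = a3 \<or> b 2 = c 2) \<longrightarrow>
              real_of_int a3 = real_of_int (bb * (bb - 1)) / 2)"
proof -
  interpret G: drg3 E n b c using drg by unfold_locales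
  define A where "A = intersection_a b c 3"
  define B where "B = A - intersection_a b c 1"
  define s where "s = int (b 2) + int (c 2)"
  define t where "t = A - s"
  define p where "p = (B - 1) * (int (b 2) - A) - t"
  have a3: "G.a 3 = real_of_int A" and a1: "G.a 1 = real_of_int A - real_of_int B"
    by (simp_all add: A_def B_def)
  have c3: "real (c 3) > 0" and c2: "int (c 2) > 0" using G.c_pos[of 3] G.c_pos[of 2] by auto
  \<comment> \<open>By the Shilla condition \<open>\<theta> 1\<close> is \<open>a 3\<close>, which
    is the valency minus the positive number \<open>c 3\<close>.\<close>
  have "\<theta> 1 < G.k" using shilla c3 G.a_eq(4) by simp
  note sp = G.spectrum_of_small_theta_1[OF eigs decr this]
  have h3: "G.hoffman (G.a 3) = 0" using sp(3) shilla by simp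
  note par = G.shilla_parameters[OF h3, unfolded a3 a1]
  have K: "G.k = real_of_int A * real_of_int B" using par(1) by simp
  have B2: "B \<ge> 2" using bge2 by (simp add: A_def B_def)
  have "G.k > 0" using G.b_pos[of 0] by simp
  hence Apos: "A > 0" unfolding K using B2 by (simp add: zero_less_mult_iff)
  have AB: "A \<ge> B" using G.intersection_a_nonneg[of 1] by (simp add: B_def)
  have lt: "\<theta> 2 < \<theta> 1" "\<theta> 3 < \<theta> 1" "\<theta> 3 < \<theta> 2" using decr[of 1 2] decr[of 1 3] decr[of 2 3] by auto
  have th1: "\<theta> 1 = A" using shilla by (simp add: A_def)
  have quad: "x\<^sup>2 + (real_of_int B + real (b 2) + real (c 2) - real_of_int A) * x
      + (real_of_int B * real (b 2) + real (c 2) - real_of_int A * real_of_int B) = 0"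
    if "G.hoffman x = 0" "x < \<theta> 1" for x
    using that G.hoffman_shilla_factor[OF h3, of x] unfolding a3 a1 th1 by simp
  have "\<theta> 2 \<noteq> \<theta> 3" using lt by simp
  note sum_prod = monic_quadratic_sum_prod[OF quad[OF sp(4) lt(1)] quad[OF sp(5) lt(2)] this]
  have sum: "\<theta> 2 + \<theta> 3 = real_of_int (t - B)"
    using sum_prod(1) by (simp add: t_def s_def)
  have prod: "\<theta> 2 * \<theta> 3 = real_of_int p"
    using sum_prod(2) by (simp add: p_def t_def s_def algebra_simps)
  define m m1 where "m = real (eig_mult (adj_matrix E n) (\<theta> 3))"
    and "m1 = real (eig_mult (adj_matrix E n) (\<theta> 1))"
  have "inj_on \<theta> {0..3}" by (rule inj_onI) (metis atLeastAtMost_iff decr less_irrefl nat_neq_iff)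
  from G.trace_spectrum[OF eigs this]
  have tr: "G.k ^ i + m1 * real_of_int A ^ i + m * (\<theta> 2 ^ i + \<theta> 3 ^ i) = mtrace (adj_matrix E n ^\<^sub>m i)" for i
    using sp(1,2) th1 mult by (simp add: m_def m1_def numeral_3_eq_3 numeral_2_eq_2 algebra_simps)
  have hyps: "1 + m1 + 2 * m = real n" "G.k + m1 * A + m * (\<theta> 2 + \<theta> 3) = 0"
    "(G.k)\<^sup>2 + m1 * (real_of_int A)\<^sup>2 + m * ((\<theta> 2)\<^sup>2 + (\<theta> 3)\<^sup>2) = real n * G.k"
    "G.k ^ 3 + m1 * real_of_int A ^ 3 + m * (\<theta> 2 ^ 3 + \<theta> 3 ^ 3) = real n * G.k * (real_of_int A - real_of_int B)"
    using tr[of 0] tr[of 1] tr[of 2] tr[of 3] unfolding G.trace_adj a1 by simp_all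
  have pos: "real_of_int A > 0" "real_of_int B > 0" "real n > 0" "m \<ge> 0" "m1 \<ge> 0"
    using Apos B2 G.n_pos by (simp_all add: m_def m1_def)
  note em = equal_multiplicities[OF hyps K pos \<open>\<theta> 2 \<noteq> \<theta> 3\<close>]
  have "real_of_int (t - B) < 0" using em(1) unfolding sum .
  \<comment> \<open>As \<open>t = A - s\<close>, this is the lower bound in (i); \<open>i2\<close>
    below is the upper bound.\<close>
  hence i1: "t < B" by simp
  have "0 < 2 * real_of_int B + real_of_int (t - B)" using em(2) unfolding sum .
  hence i2: "- B < t" by linarith
  \<comment> \<open>All quantities are integers, so the equation between real eigenvalues becomes an
    integer equation to which divisibility arguments apply.\<close>
  have "real_of_int (((t - B)\<^sup>2 - 4 * p) * (A * B + A - (t - B))) =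
      real_of_int ((2 * B + (t - B)) * ((t - B)\<^sup>2 - 2 * p - (A * B + A) * (t - B) + 2 * (A * B) * A))"
    using em(3) unfolding sum prod K
    by (simp only: of_int_mult of_int_add of_int_diff of_int_power of_int_numeral)
  hence eq: "((t - B)\<^sup>2 - 4 * p) * (A * B + A - (t - B)) =
      (t + B) * ((t - B)\<^sup>2 - 2 * p - (A * B + A) * (t - B) + 2 * (A * B) * A)"
    unfolding of_int_eq_iff by (simp add: add.commute)
  have "real (c 2) * real (c 3) * (1 + real_of_int A) + real (c 3) * (real (b 2) * real (c 3))
      \<le> real (c 3) * ((real_of_int A + 1) * real_of_int B * real (b 2))"
  proof -
    have rhs: "real (b 1) * real (b 2) * G.k = real (c 3) * ((real_of_int A + 1) * real_of_int B * real (b 2))"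
      unfolding par K by (simp add: algebra_simps)
    \<comment> \<open>The relation \<open>K\<close> makes the terms after \<open>r\<close> cancel,
      and both sides of the inequality for distance 3 acquire the factor \<open>c 3\<close>.\<close>
    have lhs: "r + (real_of_int A)\<^sup>2 - G.k - (real_of_int A - real_of_int B) * real_of_int A = r" for r
      unfolding K by (simp add: algebra_simps power2_eq_square)
    show ?thesis using G.intersection_number_333 unfolding a3 a1 lhs rhs .
  qed
  hence "real (c 3) * (real (c 2) * (1 + real_of_int A) + real (b 2) * real (c 3)) \<le> real (c 3) * ((real_of_int A + 1) * real_of_int B * real (b 2))"
    by (simp add: algebra_simps)
  hence "real (c 2) * (1 + real_of_int A) + real (b 2) * real (c 3) \<le> (real_of_int A + 1) * real_of_int B * real (b 2)"
    using c3 by simp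
  \<comment> \<open>Substituting \<open>c 3 = A * (B - 1)\<close> cancels the terms containing
    \<open>A * B * b 2\<close>.\<close>
  hence "real_of_int ((A + 1) * int (c 2)) \<le> real_of_int ((A + B) * int (b 2))"
    unfolding par by (simp add: algebra_simps)
  hence p333: "(A + 1) * int (c 2) \<le> (A + B) * int (b 2)" by (simp only: of_int_le_iff)
  have ii: "int (c 2) < int (b 2) + B"
    using shilla_c2_less[OF p333 _ Apos B2] i2 by (simp add: t_def s_def)
  have iii: "real_of_int A = real_of_int (B * (B - 1)) / 2" if "int (b 2) + int (c 2) = A \<or> b 2 = c 2"
  proof -
    have "2 * A = B * (B - 1)"
      using shilla_integer_cases[OF Apos AB B2 c2 _ _ p_def eq] that i1 i2
      by (auto simp: t_def s_def)
    hence "2 * real_of_int A = real_of_int (B * (B - 1))" by (metis of_int_mult of_int_numeral)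
    thus ?thesis by simp
  qed
  show ?thesis
    unfolding Let_def A_def[symmetric] B_def[symmetric]
    using i1 i2 ii iii by (auto simp: t_def s_def)
qed

end
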